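(* Let $G$ be a graph and $\mathcal{P}$ a maximal $P_2$-packing of $G$ of size $j$. If $G$ has a $P_2$-packing of size $j+1$, then there is a packing $\mathcal{Q}\in\mathfrak{Q}_{(2)}$ such that $|V(\mathcal{P})\cap V(\mathcal{Q})|\ge 2.5j$.
   Context: A $P_2$ is a path with three vertices and two edges. A $P_2$-packing is a set of pairwise vertex-disjoint $P_2$'s in $G$; it is maximal if no further $P_2$ vertex-disjoint from all members can be added. $V(\cdot)$, $E(\cdot)$ denote vertex/edge sets (unions for sets of paths). $\mathfrak{Q}_{(1)}$ is the set of $P_2$-packings $\mathcal{Q}$ of $G$ of size $j+1$ maximizing $\sum_{p\in\mathcal{P}}\sum_{q\in\mathcal{Q}}1_{[E(p)=E(q)]}$; $\mathfrak{Q}_{(2)}$ is the set of those $\mathcal{Q}\in\mathfrak{Q}_{(1)}$ maximizing $\sum_{p\in\mathcal{P}}\sum_{q\in\mathcal{Q}}|E(p)\cap E(q)|$. *)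

theory Defs
  imports Complex_Main
begin

record 'a ugraph =
  verts :: "'a set"
  edges :: "'a set set"

definition simple_graph :: "'a ugraph \<Rightarrow> bool" where
  "simple_graph G \<longleftrightarrow> finite (verts G) \<and> (\<forall>e\<in>edges G. e \<subseteq> verts G \<and> card e = 2)"

definition subgraph :: "'a ugraph \<Rightarrow> 'a ugraph \<Rightarrow> bool" where
  "subgraph H G \<longleftrightarrow> verts H \<subseteq> verts G \<and> edges H \<subseteq> edges G"

definition is_P2 :: "'a ugraph \<Rightarrow> bool" where
  "is_P2 p \<longleftrightarrow> (\<exists>u v w. distinct [u, v, w] \<and>
     p = \<lparr>verts = {u, v, w}, edges = {{u, v}, {v, w}}\<rparr>)"

definition P2_of :: "'a ugraph \<Rightarrow> 'a ugraph \<Rightarrow> bool" where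
  "P2_of G p \<longleftrightarrow> is_P2 p \<and> subgraph p G"

definition P2_packing :: "'a ugraph \<Rightarrow> 'a ugraph set \<Rightarrow> bool" where
  "P2_packing G P \<longleftrightarrow> (\<forall>p\<in>P. P2_of G p) \<and> pairwise (\<lambda>p q. disjnt (verts p) (verts q)) P"

definition maximal_P2_packing :: "'a ugraph \<Rightarrow> 'a ugraph set \<Rightarrow> bool" where
  "maximal_P2_packing G P \<longleftrightarrow> P2_packing G P \<and>
     \<not> (\<exists>q. P2_of G q \<and> (\<forall>p\<in>P. disjnt (verts q) (verts p)))"

definition Verts :: "'a ugraph set \<Rightarrow> 'a set" where
  "Verts P = (\<Union>p\<in>P. verts p)"

definition common_paths :: "'a ugraph set \<Rightarrow> 'a ugraph set \<Rightarrow> nat" where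
  "common_paths P Q = (\<Sum>p\<in>P. \<Sum>q\<in>Q. of_bool (edges p = edges q))"

definition common_edges :: "'a ugraph set \<Rightarrow> 'a ugraph set \<Rightarrow> nat" where
  "common_edges P Q = (\<Sum>p\<in>P. \<Sum>q\<in>Q. card (edges p \<inter> edges q))"

definition Q1 :: "'a ugraph \<Rightarrow> 'a ugraph set \<Rightarrow> nat \<Rightarrow> 'a ugraph set set" where
  "Q1 G P j = {Q. is_arg_max (common_paths P) (\<lambda>Q. P2_packing G Q \<and> card Q = j + 1) Q}"

definition Q2 :: "'a ugraph \<Rightarrow> 'a ugraph set \<Rightarrow> nat \<Rightarrow> 'a ugraph set set" where
  "Q2 G P j = {Q. is_arg_max (common_edges P) (\<lambda>Q. Q \<in> Q1 G P j) Q}"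

end

theory Submission
  imports Defs
begin

text \<open>
  Every \<open>Q\<close> in \<open>Q2 G P j\<close> satisfies the bound, by two exchange arguments. If a path \<open>p\<close> of \<open>P\<close> meets
  \<open>Q\<close> inside a single path \<open>q\<close> of \<open>Q\<close> outside \<open>P\<close>, then replacing \<open>q\<close> by \<open>p\<close> increases the number of
  common paths; hence every \<open>p\<close> has at least two vertices in \<open>Verts Q\<close>. Suppose that \<open>p\<close> has exactly
  two, and let \<open>{x, y}\<close> be an edge of \<open>p\<close> with \<open>x\<close> covered by \<open>q\<close> in \<open>Q\<close> and \<open>y\<close> uncovered. Rerouting
  \<open>q\<close> through \<open>{x, y}\<close> gains a common edge, so it must also lose one: \<open>q\<close> has the form \<open>x - b - c\<close>
  with \<open>{b, c}\<close> an edge of another path \<open>p'\<close> of \<open>P\<close>. This \<open>p'\<close> has all three vertices in \<open>Verts Q\<close>,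
  and it determines \<open>q\<close> (which owns two of its three vertices) and then \<open>p\<close> (which owns the third
  vertex of \<open>q\<close>). So at most half of the paths of \<open>P\<close> have only two covered vertices.
\<close>

section \<open>Paths on three vertices and packings of them\<close>

lemma is_P2I:
  "u \<noteq> v \<Longrightarrow> v \<noteq> w \<Longrightarrow> u \<noteq> w \<Longrightarrow> is_P2 \<lparr>verts = {u, v, w}, edges = {{u, v}, {v, w}}\<rparr>"
  unfolding is_P2_def by auto

lemma is_P2E:
  assumes "is_P2 p"
  obtains u v w where "u \<noteq> v" "v \<noteq> w" "u \<noteq> w" "verts p = {u, v, w}" "edges p = {{u, v}, {v, w}}"
  using assms unfolding is_P2_def by auto

lemma is_P2_card_verts: "is_P2 p \<Longrightarrow> card (verts p) = 3"
  by (erule is_P2E) auto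

lemma is_P2_finite_verts: "is_P2 p \<Longrightarrow> finite (verts p)"
  by (erule is_P2E) auto

lemma is_P2_Union_edges: "is_P2 p \<Longrightarrow> \<Union>(edges p) = verts p"
  by (erule is_P2E) auto

text \<open>The edges of such a path cover its vertices, so the comparison of edge sets in
  \<open>common_paths\<close> amounts to equality of paths.\<close>

lemma is_P2_edges_inject: "is_P2 p \<Longrightarrow> is_P2 q \<Longrightarrow> edges p = edges q \<Longrightarrow> p = q"
  by (metis is_P2_Union_edges ugraph.equality unit.exhaust)

lemma P2_packing_is_P2: "P2_packing G P \<Longrightarrow> p \<in> P \<Longrightarrow> is_P2 p"
  by (auto simp: P2_packing_def P2_of_def)

lemma P2_packing_eq_if_meet:
  "P2_packing G P \<Longrightarrow> p \<in> P \<Longrightarrow> q \<in> P \<Longrightarrow> x \<in> verts p \<Longrightarrow> x \<in> verts q \<Longrightarrow> p = q"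
  by (auto simp: P2_packing_def pairwise_def disjnt_iff)

lemma finite_P2_of: "simple_graph G \<Longrightarrow> finite {p. P2_of G p}"
proof -
  assume G: "simple_graph G"
  have "edges G \<subseteq> Pow (verts G)"
    using G by (auto simp: simple_graph_def)
  then have "finite (Pow (verts G) \<times> Pow (edges G))"
    using G by (auto simp: simple_graph_def intro: finite_subset)
  moreover have "(\<lambda>p. (verts p, edges p)) ` {p. P2_of G p} \<subseteq> Pow (verts G) \<times> Pow (edges G)"
    by (auto simp: P2_of_def subgraph_def)
  moreover have "inj_on (\<lambda>p. (verts p, edges p)) {p. P2_of G p}"
    by (auto simp: inj_on_def P2_of_def intro: is_P2_edges_inject)
  ultimately show ?thesis
    by (meson finite_imageD finite_subset)
qed

lemma finite_P2_packing: "simple_graph G \<Longrightarrow> P2_packing G P \<Longrightarrow> finite P"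
  by (rule finite_subset[OF _ finite_P2_of[of G]]) (auto simp: P2_packing_def)

section \<open>Existence of an optimal packing\<close>

lemma ex_is_arg_max_if_finite:
  fixes f :: "'b \<Rightarrow> nat"
  assumes "finite {x. A x}" "A a"
  shows "\<exists>x. is_arg_max f A x"
proof -
  \<comment> \<open>\<open>arg_max_nat_lemma\<close> wants a strict upper bound, hence the successor
    of the maximum.\<close>
  have "\<forall>y. A y \<longrightarrow> f y < Suc (Max (f ` {x. A x}))"
    using assms by (auto simp: le_imp_less_Suc)
  then have "A (arg_max f A) \<and> (\<forall>y. A y \<longrightarrow> f y \<le> f (arg_max f A))"
    using arg_max_nat_lemma[of A a f] assms(2) by blast
  then show ?thesis
    by (auto simp: is_arg_max_def not_less)
qed

text \<open>A finite graph has finitely many packings, so both successive maxima are attained once a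
  packing of the right size exists.\<close>

lemma Q2_nonempty:
  assumes "simple_graph G" "P2_packing G R" "card R = j + 1"
  shows "Q2 G P j \<noteq> {}"
proof -
  have fin: "finite {Q. P2_packing G Q \<and> card Q = j + 1}"
    by (rule finite_subset[of _ "Pow {p. P2_of G p}"])
      (use finite_P2_of[OF assms(1)] in \<open>auto simp: P2_packing_def\<close>)
  then obtain Q where "Q \<in> Q1 G P j"
    using ex_is_arg_max_if_finite[OF fin] assms unfolding Q1_def by blast
  moreover have "finite {Q. Q \<in> Q1 G P j}"
    by (rule finite_subset[OF _ fin]) (auto simp: Q1_def is_arg_max_def)
  ultimately show ?thesis
    using ex_is_arg_max_if_finite[of "\<lambda>Q. Q \<in> Q1 G P j"] unfolding Q2_def by blast
qed

section \<open>Exchanging one path of a packing\<close>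

lemma P2_packing_exchange:
  assumes "simple_graph G" "P2_packing G Q" "q \<in> Q" "P2_of G r" "verts r \<inter> Verts Q \<subseteq> verts q"
  shows "P2_packing G (insert r (Q - {q}))" "r \<notin> Q - {q}" "card (insert r (Q - {q})) = card Q"
proof -
  have disj: "disjnt (verts r) (verts s)" if "s \<in> Q - {q}" for s
  proof -
    have "verts r \<inter> verts s \<subseteq> verts q"
      using that assms(5) by (auto simp: Verts_def)
    moreover have "verts s \<inter> verts q = {}"
      using P2_packing_eq_if_meet[OF assms(2), of s q] that assms(3) by blast
    ultimately show ?thesis by (auto simp: disjnt_def)
  qed
  have "pairwise (\<lambda>p q. disjnt (verts p) (verts q)) (Q - {q})"
    using assms(2) by (auto simp: P2_packing_def intro: pairwise_subset)
  then have "pairwise (\<lambda>p q. disjnt (verts p) (verts q)) (insert r (Q - {q}))"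
    using disj disjnt_sym unfolding pairwise_insert by blast
  then show "P2_packing G (insert r (Q - {q}))"
    using assms(2,4) unfolding P2_packing_def by blast
  \<comment> \<open>If \<open>r\<close> were in \<open>Q - {q}\<close>, it would be disjoint from
    itself.\<close>
  have "verts r \<noteq> {}"
    using assms(4) by (auto simp: P2_of_def elim: is_P2E)
  then show *: "r \<notin> Q - {q}"
    using disj by fastforce
  show "card (insert r (Q - {q})) = card Q"
    using * finite_P2_packing[OF assms(1,2)] assms(3) card.remove[of Q q] by simp
qed

text \<open>Written additively to avoid truncated subtraction on naturals.\<close>

lemma sum_exchange:
  fixes f :: "'b \<Rightarrow> nat"
  assumes "finite Q" "q \<in> Q" "r \<notin> Q - {q}"
  shows "sum f (insert r (Q - {q})) + f q = sum f Q + f r"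
  using assms sum.remove[OF assms(1,2), of f] by simp

text \<open>As \<open>q\<close> is not in \<open>P\<close>, giving it up costs no common path.
  Gaining one would contradict membership in \<open>Q1\<close>; so the exchanged packing is again in
  \<open>Q1\<close>, and the second maximum compares the common edges.\<close>

lemma Q2_exchange_notin:
  assumes G: "simple_graph G" and P: "P2_packing G P" and Q: "Q \<in> Q2 G P j"
    and q: "q \<in> Q" "q \<notin> P" and r: "P2_of G r" "verts r \<inter> Verts Q \<subseteq> verts q"
  shows "r \<notin> P"
    and "(\<Sum>p\<in>P. card (edges p \<inter> edges r)) \<le> (\<Sum>p\<in>P. card (edges p \<inter> edges q))"
proof -
  let ?R = "insert r (Q - {q})"
  define f where "f s = (\<Sum>p\<in>P. of_bool (edges p = edges s) :: nat)" for s :: "'a ugraph"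
  define g where "g s = (\<Sum>p\<in>P. card (edges p \<inter> edges s))" for s :: "'a ugraph"
  have Q1: "Q \<in> Q1 G P j" and maxe: "\<And>R. R \<in> Q1 G P j \<Longrightarrow> common_edges P R \<le> common_edges P Q"
    using Q by (auto simp: Q2_def is_arg_max_def not_less)
  have pack: "P2_packing G Q" "card Q = j + 1"
    and maxp: "\<And>R. P2_packing G R \<Longrightarrow> card R = j + 1 \<Longrightarrow> common_paths P R \<le> common_paths P Q"
    using Q1 by (auto simp: Q1_def is_arg_max_def not_less)
  note ex = P2_packing_exchange[OF G pack(1) q(1) r]
  have fin: "finite Q" "finite P"
    using finite_P2_packing G P pack by blast+
  \<comment> \<open>Swapping the sums makes both objectives additive over the members of the
    packing.\<close>
  have cp: "common_paths P R = sum f R" and ce: "common_edges P R = sum g R" for R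
    unfolding common_paths_def common_edges_def f_def g_def by (rule sum.swap)+
  have fq: "f q = 0"
    unfolding f_def
  proof (rule sum.neutral, intro ballI)
    fix p assume "p \<in> P"
    then have "edges p \<noteq> edges q"
      using q is_P2_edges_inject P2_packing_is_P2[OF P] P2_packing_is_P2[OF pack(1)] by metis
    then show "of_bool (edges p = edges q) = (0 :: nat)" by simp
  qed
  have "common_paths P ?R \<le> common_paths P Q"
    using maxp ex pack by simp
  with sum_exchange[OF fin(1) q(1) ex(2), of f] fq have fr: "f r = 0"
    by (simp add: cp)
  then show "r \<notin> P"
    using fin by (auto simp: f_def)
  have "common_paths P ?R = common_paths P Q"
    using sum_exchange[OF fin(1) q(1) ex(2), of f] fq fr by (simp add: cp)
  then have "?R \<in> Q1 G P j"
    using maxp ex pack by (simp add: Q1_def is_arg_max_def not_less)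
  from maxe[OF this] sum_exchange[OF fin(1) q(1) ex(2), of g] have "g r \<le> g q"
    by (simp add: ce)
  then show "(\<Sum>p\<in>P. card (edges p \<inter> edges r)) \<le> (\<Sum>p\<in>P. card (edges p \<inter> edges q))"
    by (simp add: g_def)
qed

lemma Q2_packing: "Q \<in> Q2 G P j \<Longrightarrow> P2_packing G Q \<and> card Q = j + 1"
  by (auto simp: Q2_def Q1_def is_arg_max_def)

lemma Q2_meets_twice:
  assumes G: "simple_graph G" and P: "P2_packing G P" "card P = j" and Q: "Q \<in> Q2 G P j"
    and p: "p \<in> P"
  shows "2 \<le> card (verts p \<inter> Verts Q)"
proof (rule ccontr)
  assume less: "\<not> 2 \<le> card (verts p \<inter> Verts Q)"
  have fin: "finite P" "finite (verts p)" and P2: "is_P2 p" "P2_of G p"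
    using finite_P2_packing[OF G P(1)] is_P2_finite_verts P2_packing_is_P2[OF P(1) p] P(1) p
    by (auto simp: P2_packing_def)
  have "\<exists>q\<in>Q. q \<notin> P \<and> verts p \<inter> Verts Q \<subseteq> verts q"
  proof (cases "verts p \<inter> Verts Q = {}")
    case True
    \<comment> \<open>\<open>Q\<close> has one member more than \<open>P\<close>; any member outside
      \<open>P\<close> will do, since \<open>p\<close> meets nothing.\<close>
    have "\<not> Q \<subseteq> P"
      using card_mono[OF fin(1), of Q] P(2) Q2_packing[OF Q] by auto
    then show ?thesis using True by blast
  next
    case False
    then have "card (verts p \<inter> Verts Q) = 1"
      using less fin by (metis One_nat_def card_eq_0_iff finite_Int less_2_cases not_le)
    then obtain x where x: "verts p \<inter> Verts Q = {x}"
      by (meson card_1_singletonE)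
    then obtain q where q: "q \<in> Q" "x \<in> verts q"
      by (auto simp: Verts_def)
    have "q \<notin> P"
    proof
      assume "q \<in> P"
      then have "q = p"
        using P2_packing_eq_if_meet[OF P(1) _ p q(2)] x by blast
      then have "verts p \<inter> Verts Q = verts p"
        using q by (auto simp: Verts_def)
      then show False
        using less is_P2_card_verts[OF P2(1)] by simp
    qed
    then show ?thesis using q x by (intro bexI[of _ q]) auto
  qed
  then show False
    using Q2_exchange_notin(1)[OF G P(1) Q _ _ P2(2)] p by blast
qed

section \<open>Partners of paths with one uncovered vertex\<close>

lemma P2_uncovered_edge:
  assumes "is_P2 p" "card (verts p \<inter> V) = 2"
  obtains x y z where "verts p = {x, y, z}" "{x, y} \<in> edges p" "x \<in> V" "y \<notin> V" "x \<noteq> y"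
    "z \<in> V" "z \<noteq> x"
proof -
  obtain u v w where p: "u \<noteq> v" "v \<noteq> w" "u \<noteq> w" "verts p = {u, v, w}"
      "edges p = {{u, v}, {v, w}}"
    using assms(1) by (rule is_P2E)
  have "(u \<notin> V \<and> v \<in> V \<and> w \<in> V) \<or> (u \<in> V \<and> v \<notin> V \<and> w \<in> V) \<or> (u \<in> V \<and> v \<in> V \<and> w \<notin> V)"
    using assms(2) p(1-4) by (cases "u \<in> V"; cases "v \<in> V"; cases "w \<in> V") auto
  \<comment> \<open>If an end is uncovered, \<open>x\<close> is the centre; if the centre is, either
    end can serve as \<open>x\<close>.\<close>
  then show ?thesis
    using that[of v u w] that[of u v w] that[of v w u] p by (auto simp: insert_commute)
qed

text \<open>In the first case \<open>x\<close> is the centre of \<open>q\<close>, in the second an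
  end.\<close>

lemma P2_split_at:
  assumes "is_P2 q" "x \<in> verts q"
  obtains a b where "x \<noteq> a" "x \<noteq> b" "a \<noteq> b" "verts q = {x, a, b}" "edges q = {{x, a}, {x, b}}"
  | b c where "x \<noteq> b" "x \<noteq> c" "b \<noteq> c" "verts q = {x, b, c}" "edges q = {{x, b}, {b, c}}"
proof -
  obtain u v w where q: "u \<noteq> v" "v \<noteq> w" "u \<noteq> w" "verts q = {u, v, w}"
      "edges q = {{u, v}, {v, w}}"
    using assms(1) by (rule is_P2E)
  then consider "x = u" | "x = v" | "x = w" using assms(2) by auto
  then show ?thesis
  proof cases
    case 1 then show ?thesis using that(2)[of v w] q by auto
  next
    case 2 then show ?thesis using that(1)[of u w] q by (auto simp: insert_commute)
  next
    case 3 then show ?thesis using that(2)[of v u] q by (auto simp: insert_commute)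
  qed
qed

lemma Q2_partner:
  assumes G: "simple_graph G" and P: "P2_packing G P" "card P = j" and Q: "Q \<in> Q2 G P j"
    and p: "p \<in> P" "card (verts p \<inter> Verts Q) = 2"
  obtains p' q where "p' \<in> P" "p' \<noteq> p" "verts p' \<subseteq> Verts Q" "q \<in> Q" "verts q \<inter> verts p \<noteq> {}"
    "2 \<le> card (verts q \<inter> verts p')"
proof -
  have packQ: "P2_packing G Q" and finP: "finite P"
    using Q2_packing[OF Q] finite_P2_packing[OF G P(1)] by auto
  \<comment> \<open>Otherwise \<open>s\<close> could replace \<open>q\<close>, gaining a common
    path.\<close>
  have sole: "q \<in> P" if "s \<in> P" "q \<in> Q" "verts s \<inter> Verts Q \<subseteq> verts q" for s q
    using Q2_exchange_notin(1)[OF G P(1) Q that(2) _ _ that(3)] that(1) P(1)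
    by (auto simp: P2_packing_def)
  obtain x y z where xyz: "verts p = {x, y, z}" "{x, y} \<in> edges p" "x \<in> Verts Q" "y \<notin> Verts Q"
      "x \<noteq> y" "z \<in> Verts Q" "z \<noteq> x"
    using P2_uncovered_edge[OF P2_packing_is_P2[OF P(1) p(1)] p(2)] .
  then obtain q where q: "q \<in> Q" "x \<in> verts q"
    by (auto simp: Verts_def)
  have yq: "y \<notin> verts q"
    using xyz(4) q(1) by (auto simp: Verts_def)
  have qP: "q \<notin> P"
    using P2_packing_eq_if_meet[OF P(1) _ p(1) q(2)] xyz(1) yq by auto
  have zq: "z \<notin> verts q"
    using sole[OF p(1) q(1)] qP xyz q(2) by auto
  have p_only: "s = p" if "s \<in> P" "x \<in> \<Union>(edges s)" for s
    using that P2_packing_eq_if_meet[OF P(1) _ p(1)] xyz(1) P2_packing_is_P2[OF P(1)]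
    by (metis insertI1 is_P2_Union_edges)
  \<comment> \<open>An edge of \<open>P\<close> at \<open>x\<close> belongs to \<open>p\<close>,
    whose other vertices \<open>y\<close> and \<open>z\<close> lie off \<open>q\<close>. So no edge
    of \<open>q\<close> at \<open>x\<close> is shared with \<open>P\<close>.\<close>
  have xedge: "{x, t} \<notin> edges s" if "s \<in> P" "t \<in> verts q" "t \<noteq> x" for s t
  proof
    assume e: "{x, t} \<in> edges s"
    then have "s = p" using p_only that(1) by blast
    then have "t \<in> verts p"
      using e is_P2_Union_edges[OF P2_packing_is_P2[OF P(1) p(1)]] by blast
    then show False using xyz(1) yq zq that by auto
  qed
  have reroute: "\<exists>s\<in>P. edges s \<inter> edges q \<noteq> {}" if t: "{x, t} \<in> edges q" "t \<noteq> x" "t \<in> verts q" for t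
  proof -
    \<comment> \<open>\<open>?r\<close> keeps the edge \<open>{x, t}\<close> of \<open>q\<close> and
      trades the other one for the edge \<open>{x, y}\<close> of \<open>p\<close>, so it shares an
      edge with \<open>P\<close>; by optimality \<open>q\<close> must share one too.\<close>
    let ?r = "\<lparr>verts = {y, x, t}, edges = {{y, x}, {x, t}}\<rparr>"
    have "y \<noteq> t" using t yq by auto
    then have "is_P2 ?r"
      using is_P2I[of y x t] xyz(5) t by auto
    moreover have "subgraph q G" "subgraph p G"
      using packQ q(1) P(1) p(1) by (auto simp: P2_packing_def P2_of_def)
    ultimately have r: "P2_of G ?r"
      using xyz(1,2) t by (auto simp: P2_of_def subgraph_def insert_commute)
    have "(\<Sum>s\<in>P. card (edges s \<inter> edges ?r)) \<le> (\<Sum>s\<in>P. card (edges s \<inter> edges q))"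
      by (rule Q2_exchange_notin(2)[OF G P(1) Q q(1) qP r]) (use xyz(4) q(2) t in auto)
    moreover have "edges p \<inter> edges ?r \<noteq> {}"
      using xyz(2) by (auto simp: insert_commute)
    then have "0 < card (edges p \<inter> edges ?r)"
      by (simp add: card_gt_0_iff)
    then have "0 < (\<Sum>s\<in>P. card (edges s \<inter> edges ?r))"
      using finP p(1) by (meson sum_pos2 zero_le)
    ultimately have "(\<Sum>s\<in>P. card (edges s \<inter> edges q)) \<noteq> 0" by simp
    then obtain s where "s \<in> P" "card (edges s \<inter> edges q) \<noteq> 0"
      by (rule sum.not_neutral_contains_not_neutral)
    then show ?thesis
      by (intro bexI[of _ s]) (simp_all, metis card.empty less_irrefl)
  qed
  from P2_packing_is_P2[OF packQ q(1)] q(2) show ?thesis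
  proof (cases rule: P2_split_at)
    \<comment> \<open>Both edges of \<open>q\<close> contain \<open>x\<close>, so neither can be
      shared: this case is impossible.\<close>
    case (1 a b)
    then obtain s where "s \<in> P" "edges s \<inter> edges q \<noteq> {}"
      using reroute[of a] by auto
    then show ?thesis
      using xedge[of s a] xedge[of s b] 1 by auto
  next
    case (2 b c)
    then obtain p' where p': "p' \<in> P" "edges p' \<inter> edges q \<noteq> {}"
      using reroute[of b] by auto
    then have "{b, c} \<in> edges p'"
      using xedge[of p' b] 2 by auto
    then have bc: "b \<in> verts p'" "c \<in> verts p'"
      using is_P2_Union_edges[OF P2_packing_is_P2[OF P(1) p'(1)]] by blast+
    have fin': "finite (verts p')" and card': "card (verts p') = 3"
      using P2_packing_is_P2[OF P(1) p'(1)] by (auto simp: is_P2_card_verts is_P2_finite_verts)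
    have bcQ: "{b, c} \<subseteq> verts p' \<inter> Verts Q"
      using bc 2 q(1) by (auto simp: Verts_def)
    \<comment> \<open>Otherwise \<open>b\<close> and \<open>c\<close> are the only covered vertices
      of \<open>p'\<close>; both lie in \<open>q\<close>, which \<open>sole\<close> would place in
      \<open>P\<close>.\<close>
    have "verts p' \<subseteq> Verts Q"
    proof (rule ccontr)
      assume "\<not> verts p' \<subseteq> Verts Q"
      then have "card (verts p' \<inter> Verts Q) < card (verts p')"
        by (intro psubset_card_mono fin') auto
      then have "card (verts p' \<inter> Verts Q) \<le> card {b, c}"
        using card' 2 by simp
      then have "{b, c} = verts p' \<inter> Verts Q"
        using bcQ fin' by (intro card_seteq) auto
      then show False
        using sole[OF p'(1) q(1)] qP 2 by auto
    qed
    moreover have "p' \<noteq> p"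
      using bc xyz(1) yq zq 2 by auto
    moreover have "card {b, c} \<le> card (verts q \<inter> verts p')"
      by (rule card_mono) (use fin' bc 2 in auto)
    ultimately show ?thesis
      using that[of p' q] p'(1) q xyz(1) 2 by auto
  qed
qed

text \<open>Two disjoint pairs do not fit into the three vertices of \<open>p'\<close>, so
  \<open>q1 = q2\<close>. This path has at most one vertex off \<open>p'\<close>, and
  \<open>p1\<close> and \<open>p2\<close> both contain it.\<close>

lemma partner_inject:
  assumes P: "P2_packing G P" and Q: "P2_packing G Q" and p': "p' \<in> P"
    and p: "p1 \<in> P" "p1 \<noteq> p'" "p2 \<in> P" "p2 \<noteq> p'"
    and q: "q1 \<in> Q" "verts q1 \<inter> verts p1 \<noteq> {}" "2 \<le> card (verts q1 \<inter> verts p')"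
      "q2 \<in> Q" "verts q2 \<inter> verts p2 \<noteq> {}" "2 \<le> card (verts q2 \<inter> verts p')"
  shows "p1 = p2"
proof -
  have fin: "finite (verts p')" "card (verts p') = 3" "finite (verts q1)" "card (verts q1) = 3"
    using P2_packing_is_P2[OF P p'] P2_packing_is_P2[OF Q q(1)]
    by (auto simp: is_P2_card_verts is_P2_finite_verts)
  have "q1 = q2"
  proof (rule ccontr)
    assume "q1 \<noteq> q2"
    then have "(verts q1 \<inter> verts p') \<inter> (verts q2 \<inter> verts p') = {}"
      using P2_packing_eq_if_meet[OF Q q(1,4)] by blast
    then have "card ((verts q1 \<inter> verts p') \<union> (verts q2 \<inter> verts p')) \<ge> 4"
      using q(3,6) fin by (subst card_Un_disjoint) auto
    moreover have "card ((verts q1 \<inter> verts p') \<union> (verts q2 \<inter> verts p')) \<le> card (verts p')"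
      by (rule card_mono) (use fin in auto)
    ultimately show False using fin by simp
  qed
  then obtain x1 x2 where x: "x1 \<in> verts q1" "x1 \<in> verts p1" "x2 \<in> verts q1" "x2 \<in> verts p2"
    using q by blast
  then have "x1 \<notin> verts p'" "x2 \<notin> verts p'"
    using P2_packing_eq_if_meet[OF P] p p' by blast+
  moreover have "card (verts q1 - verts p') \<le> 1"
    using q(3) fin card_Diff_subset_Int[of "verts q1" "verts p'"] by simp
  ultimately have "x1 = x2"
    using x fin card_le_Suc0_iff_eq[of "verts q1 - verts p'"] by auto
  then show ?thesis
    using P2_packing_eq_if_meet[OF P p(1,3)] x by blast
qed

text \<open>Sending each path of \<open>B\<close> to a partner is injective into
  \<open>P - B\<close>, so the average number of covered vertices per path is at least the mean of 2
  and 3.\<close>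

lemma Q2_card_Verts_Int:
  assumes G: "simple_graph G" and P: "P2_packing G P" "card P = j" and Q: "Q \<in> Q2 G P j"
  shows "5 * j \<le> 2 * card (Verts P \<inter> Verts Q)"
proof -
  define c where "c p = card (verts p \<inter> Verts Q)" for p :: "'a ugraph"
  define B where "B = {p \<in> P. c p = 2}"
  have packQ: "P2_packing G Q" and finP: "finite P"
    using Q2_packing[OF Q] finite_P2_packing[OF G P(1)] by auto
  have fin: "finite (verts p)" "card (verts p) = 3" if "p \<in> P" for p
    using P2_packing_is_P2[OF P(1) that] by (auto simp: is_P2_card_verts is_P2_finite_verts)
  have c2: "2 \<le> c p" if "p \<in> P" for p
    using Q2_meets_twice[OF G P Q that] by (simp add: c_def)
  define R where "R p p' q \<longleftrightarrow> p' \<in> P \<and> p' \<noteq> p \<and> verts p' \<subseteq> Verts Q \<and> q \<in> Q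
    \<and> verts q \<inter> verts p \<noteq> {} \<and> 2 \<le> card (verts q \<inter> verts p')" for p p' q
  have "\<forall>p\<in>B. \<exists>p'. \<exists>q. R p p' q"
    using Q2_partner[OF G P Q] unfolding B_def c_def R_def by (smt (verit) mem_Collect_eq)
  then obtain f where f: "\<And>p. p \<in> B \<Longrightarrow> \<exists>q. R p (f p) q"
    by metis
  have "inj_on f B"
  proof (rule inj_onI)
    fix p1 p2 assume p: "p1 \<in> B" "p2 \<in> B" "f p1 = f p2"
    then obtain q1 q2 where "R p1 (f p1) q1" "R p2 (f p1) q2"
      using f by metis
    then show "p1 = p2"
      using partner_inject[OF P(1) packQ, of "f p1" p1 p2 q1 q2] p unfolding R_def B_def by auto
  qed
  \<comment> \<open>A partner has all three vertices covered, which excludes it from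
    \<open>B\<close>.\<close>
  moreover have "f ` B \<subseteq> P - B"
  proof
    fix s assume "s \<in> f ` B"
    then have s: "s \<in> P" "verts s \<subseteq> Verts Q" using f unfolding R_def by auto
    then have "c s = 3" using fin by (simp add: c_def Int_absorb2)
    then show "s \<in> P - B" using s by (simp add: B_def)
  qed
  ultimately have BP: "card B \<le> card (P - B)"
    using finP by (meson card_inj_on_le finite_Diff)
  have cardP: "card B + card (P - B) = j"
    using P(2) finP card_mono[of P B] by (auto simp: B_def card_Diff_subset)
  have "Verts P \<inter> Verts Q = (\<Union>p\<in>P. verts p \<inter> Verts Q)"
    by (auto simp: Verts_def)
  also have "card \<dots> = (\<Sum>p\<in>P. c p)"
    unfolding c_def
    by (rule card_UN_disjoint) (use finP fin P2_packing_eq_if_meet[OF P(1)] in blast)+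
  also have "\<dots> = (\<Sum>p\<in>B. c p) + (\<Sum>p\<in>P - B. c p)"
    using finP sum.subset_diff[of B P c] by (auto simp: B_def)
  finally have "card (Verts P \<inter> Verts Q) = (\<Sum>p\<in>B. c p) + (\<Sum>p\<in>P - B. c p)" .
  moreover have "(\<Sum>p\<in>B. c p) = 2 * card B"
    by (simp add: B_def)
  moreover have "3 * card (P - B) \<le> (\<Sum>p\<in>P - B. c p)"
  proof -
    have "3 \<le> c p" if "p \<in> P - B" for p
      using c2[of p] that by (auto simp: B_def)
    then show ?thesis
      using sum_bounded_below[of "P - B" 3 c] by (simp add: mult.commute)
  qed
  \<comment> \<open>With \<open>b\<close> and \<open>m\<close> the sizes of \<open>B\<close> and
    \<open>P - B\<close>, \<open>b \<le> m\<close> gives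
    \<open>2 * (2 * b + 3 * m) \<ge> 5 * (b + m)\<close>.\<close>
  ultimately show ?thesis
    using BP cardP by linarith
qed

theorem theorem5:
  fixes G :: "'a ugraph" and P :: "'a ugraph set" and j :: nat
  assumes "simple_graph G"
    and "maximal_P2_packing G P"
    and "card P = j"
    and "\<exists>R. P2_packing G R \<and> card R = j + 1"
  shows "\<exists>Q \<in> Q2 G P j. real (card (Verts P \<inter> Verts Q)) \<ge> 2.5 * real j"
proof -
  have P: "P2_packing G P"
    using assms(2) by (simp add: maximal_P2_packing_def)
  obtain Q where Q: "Q \<in> Q2 G P j"
    using Q2_nonempty[OF assms(1)] assms(4) by blast
  have "real (5 * j) \<le> real (2 * card (Verts P \<inter> Verts Q))"
    using Q2_card_Verts_Int[OF assms(1) P assms(3) Q] by (rule of_nat_mono)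
  then show ?thesis
    using Q by (intro bexI[of _ Q]) auto
qed

end
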